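(* Let $n\ge 3f+1$ and suppose the protocol publishes a $\textsc{semantic\_commit}$ in round $r$ with selected core $\widehat{C}\subseteq G_{v^\star}$ satisfying $$|\widehat{C}|>\frac{n+f}{2}.$$ Then $v^\star$ is the strict honest majority of the delivered view: strictly more than half of the agents in $\mathcal{H}_V=\mathcal{H}\cap V(r)$ hold verdict $v^\star$. In particular $v^\star=\mathrm{majority}_{\mathcal{H}}(V)$.
   Context: There are $n$ agents $\mathcal{N}=\{1,\dots,n\}$; a set $\mathcal{B}\subseteq\mathcal{N}$ with $|\mathcal{B}|\le f$ is Byzantine and $\mathcal{H}=\mathcal{N}\setminus\mathcal{B}$ is honest. A delivered view $V(r)$ consists of an index set $I_r\subseteq\mathcal{N}$ with $|I_r|\ge n-f$ and, for each $i\in I_r$, a proposal with one verdict in $\{\textsc{support},\textsc{refute},\textsc{insufficient}\}$; $\mathcal{H}\cap V(r)$ means $\mathcal{H}\cap I_r$. $G_v\subseteq I_r$ is the set of delivered agents with verdict $v$, and $v^\star=\arg\max_v|G_v|$ with ties broken by the priority $\textsc{support}>\textsc{refute}>\textsc{insufficient}$. A $\textsc{semantic\_commit}$ commits the verdict $v^\star$ and carries a selected core $\widehat{C}\subseteq G_{v^\star}$ with $|\widehat{C}|\ge 2f+1$. The honest-reference verdict $\mathrm{majority}_{\mathcal{H}}(V)$ is the verdict maximising $|G_v\cap\mathcal{H}|$, ties broken by the same priority order. *)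

theory Defs
  imports Complex_Main
begin

datatype verdict = Support | Refute | Insufficient

text \<open>Only the order of the values matters: Support > Refute > Insufficient.\<close>

fun priority :: "verdict \<Rightarrow> nat" where
  "priority Support = 2"
| "priority Refute = 1"
| "priority Insufficient = 0"

definition argmax_verdict :: "(verdict \<Rightarrow> nat) \<Rightarrow> verdict" where
  "argmax_verdict c =
     (THE v. (\<forall>w. c w \<le> c v) \<and> (\<forall>w. c w = c v \<longrightarrow> priority w \<le> priority v))"

text \<open>The description in \<^const>\<open>argmax_verdict\<close> is always proper.\<close>

lemma argmax_verdict_unique:
  fixes c :: "verdict \<Rightarrow> nat"
  shows "\<exists>!v. (\<forall>w. c w \<le> c v) \<and> (\<forall>w. c w = c v \<longrightarrow> priority w \<le> priority v)"
proof (rule ex_ex1I)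
  have all: "(\<forall>w. P w) \<longleftrightarrow> P Support \<and> P Refute \<and> P Insufficient" for P
    by (metis verdict.exhaust)
  have ex: "(\<exists>w. P w) \<longleftrightarrow> P Support \<or> P Refute \<or> P Insufficient" for P
    by (metis verdict.exhaust)
  show "\<exists>v. (\<forall>w. c w \<le> c v) \<and> (\<forall>w. c w = c v \<longrightarrow> priority w \<le> priority v)"
    unfolding all ex
    by (cases "c Refute \<le> c Support"; cases "c Insufficient \<le> c Support";
        cases "c Insufficient \<le> c Refute") auto
next
  fix u v
  assume u: "(\<forall>w. c w \<le> c u) \<and> (\<forall>w. c w = c u \<longrightarrow> priority w \<le> priority u)"
    and v: "(\<forall>w. c w \<le> c v) \<and> (\<forall>w. c w = c v \<longrightarrow> priority w \<le> priority v)"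
  then have "c u = c v" by (simp add: le_antisym)
  with u v have "priority u = priority v" by (simp add: le_antisym)
  then show "u = v" by (cases u; cases v) simp_all
qed

definition agents :: "nat \<Rightarrow> nat set" where
  "agents n = {1..n}"

definition byzantine :: "nat \<Rightarrow> nat \<Rightarrow> nat set \<Rightarrow> bool" where
  "byzantine n f B \<longleftrightarrow> B \<subseteq> agents n \<and> card B \<le> f"

definition honest :: "nat \<Rightarrow> nat set \<Rightarrow> nat set" where
  "honest n B = agents n - B"

text \<open>A view maps each delivered agent to its proposal and verdict; the index set is the
  domain of the map. The type of proposals is arbitrary.\<close>

type_synonym 'p view = "nat \<rightharpoonup> 'p \<times> verdict"

definition delivered_view :: "nat \<Rightarrow> nat \<Rightarrow> 'p view \<Rightarrow> bool" where
  "delivered_view n f V \<longleftrightarrow> dom V \<subseteq> agents n \<and> card (dom V) \<ge> n - f"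

definition holders :: "'p view \<Rightarrow> verdict \<Rightarrow> nat set" where
  "holders V v = {i. \<exists>p. V i = Some (p, v)}"

definition v_star :: "'p view \<Rightarrow> verdict" where
  "v_star V = argmax_verdict (\<lambda>v. card (holders V v))"

definition honest_majority :: "nat set \<Rightarrow> 'p view \<Rightarrow> verdict" where
  "honest_majority H V = argmax_verdict (\<lambda>v. card (holders V v \<inter> H))"

record commit =
  committed_verdict :: verdict
  selected_core :: "nat set"

definition semantic_commit :: "nat \<Rightarrow> 'p view \<Rightarrow> commit \<Rightarrow> bool" where
  "semantic_commit f V sc \<longleftrightarrow>
     committed_verdict sc = v_star V \<and>
     selected_core sc \<subseteq> holders V (v_star V) \<and>
     card (selected_core sc) \<ge> 2 * f + 1"

end

(* Let b and c be the numbers of Byzantine agents in the view and in the core, so c \<le> b \<le> f.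
   The honest part of the core has size |C| - c and all of it holds the committed verdict, while
   the view has |I| - b honest agents; from 2 |C| > n + f, n \<ge> |I| and f + b \<ge> 2 c it follows that
   2 (|C| - c) > |I| - b. A strict majority beats every other verdict, so no tie can occur. *)

theory Submission
  imports Defs
begin

text \<open>With a strict maximiser no other verdict attains the maximum, so the priority clause
  compares \<open>v\<close> only with itself.\<close>

lemma argmax_verdict_eqI:
  assumes "\<And>w. w \<noteq> v \<Longrightarrow> c w < c v"
  shows "argmax_verdict c = v"
  unfolding argmax_verdict_def
proof (rule the_equality)
  have "c w \<le> c v \<and> (c w = c v \<longrightarrow> w = v)" for w
    using assms[of w] by (cases "w = v") auto
  then show "(\<forall>w. c w \<le> c v) \<and> (\<forall>w. c w = c v \<longrightarrow> priority w \<le> priority v)"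
    by (metis order_refl)
next
  fix u
  assume "(\<forall>w. c w \<le> c u) \<and> (\<forall>w. c w = c u \<longrightarrow> priority w \<le> priority u)"
  then show "u = v"
    using assms[of u] by (meson leD)
qed

lemma holders_subset_dom: "holders V v \<subseteq> dom V"
  by (auto simp: holders_def)

lemma holders_disjoint: "v \<noteq> w \<Longrightarrow> holders V v \<inter> holders V w = {}"
  by (auto simp: holders_def)

text \<open>Holders of distinct verdicts are disjoint, so among the honest delivered agents the
  counts of \<open>v\<close> and of any one rival add up to at most the total; more than half for
  \<open>v\<close> leaves less than half for the rival. Finiteness guards against infinite sets,
  whose \<open>card\<close> is 0.\<close>

lemma honest_majority_eqI:
  assumes fin: "finite (dom V)"
    and maj: "card (H \<inter> dom V) < 2 * card (holders V v \<inter> H)"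
  shows "honest_majority H V = v"
  unfolding honest_majority_def
proof (rule argmax_verdict_eqI)
  fix w
  assume "w \<noteq> v"
  have fins: "finite (holders V u \<inter> H)" for u
    using holders_subset_dom[of V u] fin by (meson finite_Int finite_subset)
  have "card (holders V w \<inter> H) + card (holders V v \<inter> H)
      = card ((holders V w \<inter> H) \<union> (holders V v \<inter> H))"
    using holders_disjoint[OF \<open>w \<noteq> v\<close>, of V] by (intro card_Un_disjoint[symmetric] fins) auto
  also have "\<dots> \<le> card (H \<inter> dom V)"
    using holders_subset_dom[of V] fin by (intro card_mono) auto
  finally show "card (holders V w \<inter> H) < card (holders V v \<inter> H)"
    using maj by linarith
qed

lemma honest_strict_majority:
  assumes fin: "finite I" "finite B"
    and I: "card I \<le> n" and B: "card B \<le> f"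
    and C: "C \<subseteq> I" "n + f < 2 * card C"
  shows "card (I - B) < 2 * card (C - B)"
proof -
  have finC: "finite C"
    using C(1) fin(1) by (rule finite_subset)
  \<comment> \<open>Doubling \<open>card (C - B)\<close> subtracts
    \<open>card (C \<inter> B)\<close> twice from \<open>2 * card C\<close>: one copy is charged to
    \<open>I \<inter> B\<close>, which the view loses as well, and the other to
    \<open>f\<close>.\<close>
  have "card (C \<inter> B) \<le> card (I \<inter> B)" and "card (I \<inter> B) \<le> card B"
    using C(1) fin by (auto intro!: card_mono)
  moreover have "card I = card (I \<inter> B) + card (I - B)"
    using fin(1) by (rule card_Int_Diff)
  moreover have "card C = card (C \<inter> B) + card (C - B)"
    using finC by (rule card_Int_Diff)
  ultimately show ?thesis
    using I B C(2) by linarith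
qed

theorem theorem5p4:
  fixes n f r :: nat and B :: "nat set" and V :: "nat \<Rightarrow> 'p view" and sc :: commit
  assumes "n \<ge> 3 * f + 1"
    and "byzantine n f B"
    and "delivered_view n f (V r)"
    and "semantic_commit f (V r) sc"
    and "real (card (selected_core sc)) > (real n + real f) / 2"
  shows "real (card (holders (V r) (v_star (V r)) \<inter> honest n B))
           > real (card (honest n B \<inter> dom (V r))) / 2
         \<and> v_star (V r) = honest_majority (honest n B) (V r)"
proof -
  let ?I = "dom (V r)" and ?G = "holders (V r) (v_star (V r))" and ?C = "selected_core sc"
  have I: "?I \<subseteq> {1..n}" and B: "B \<subseteq> {1..n}" "card B \<le> f" and C: "?C \<subseteq> ?G"
    using assms(2-4)
    by (auto simp: byzantine_def delivered_view_def semantic_commit_def agents_def)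
  have fin: "finite ?I" "finite B"
    using I B(1) by (auto intro: finite_subset)
  have "card ?I \<le> n"
    using card_mono[OF _ I] by simp
  moreover have "?C \<subseteq> ?I"
    using C holders_subset_dom by (rule subset_trans)
  moreover have "n + f < 2 * card ?C"
  proof -
    have "real (n + f) < real (2 * card ?C)"
      using assms(5) by simp
    then show ?thesis
      by (simp only: of_nat_less_iff)
  qed
  ultimately have "card (?I - B) < 2 * card (?C - B)"
    using fin B(2) by (intro honest_strict_majority)
  \<comment> \<open>Delivered indices lie in \<open>{1..n}\<close>, so outside \<open>B\<close> they
    are honest; this turns the abstract differences into honest parts.\<close>
  moreover have "honest n B \<inter> ?I = ?I - B"
    using I by (auto simp: honest_def agents_def)
  \<comment> \<open>The core may be a proper part of its verdict class; enlarging it to the whole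
    class only raises the honest count.\<close>
  moreover have "card (?C - B) \<le> card (?G \<inter> honest n B)"
  proof (rule card_mono)
    show "finite (?G \<inter> honest n B)"
      by (simp add: honest_def agents_def)
    show "?C - B \<subseteq> ?G \<inter> honest n B"
      using C I holders_subset_dom[of "V r"] by (fastforce simp: honest_def agents_def)
  qed
  ultimately have maj: "card (honest n B \<inter> ?I) < 2 * card (?G \<inter> honest n B)"
    by simp
  then have "real (card (honest n B \<inter> ?I)) < real (2 * card (?G \<inter> honest n B))"
    by (simp only: of_nat_less_iff)
  then show ?thesis
    using honest_majority_eqI[OF fin(1) maj] by simp
qed

end
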